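(* For any graphs $G$ and $H$, the monophonic position number of the join $G \vee H$ satisfies $$\mathrm{mp}(G \vee H) = \max\{\omega(G) + \omega(H),\ \mathrm{mp}(G),\ \mathrm{mp}(H)\}.$$
   Context: All graphs are finite, simple and undirected, with at least one vertex. The join $G \vee H$ is formed from the disjoint union of $G$ and $H$ by joining every vertex of $G$ to every vertex of $H$ by an edge. $\omega(G)$ is the number of vertices in a maximum clique of $G$. A path $P$ in a graph is monophonic (induced) if the graph contains no edge between vertices that are non-consecutive on $P$. A set $M$ of vertices is a monophonic position set (mp-set) if no three vertices of $M$ lie on a common monophonic path; $\mathrm{mp}$ of a graph is the number of vertices in a largest mp-set. *)

theory Defs
  imports "Graph_Theory.Graph_Theory"
begin

text \<open>
  A finite simple undirected graph is a \<open>pair_graph\<close>: a finite, loopless, symmetric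
  digraph whose arcs are pairs of vertices.  The undirected edge between \<open>u\<close> and \<open>v\<close>
  is represented by the two arcs \<open>(u, v)\<close> and \<open>(v, u)\<close>.  The locale admits the graph without
  vertices.
\<close>

definition join :: "'a pair_pre_digraph \<Rightarrow> 'b pair_pre_digraph \<Rightarrow> ('a + 'b) pair_pre_digraph" where
  "join G H =
     \<lparr> pverts = pverts G <+> pverts H,
       parcs = {(Inl u, Inl v) | u v. (u, v) \<in> parcs G}
             \<union> {(Inr u, Inr v) | u v. (u, v) \<in> parcs H}
             \<union> {(Inl u, Inr v) | u v. u \<in> pverts G \<and> v \<in> pverts H}
             \<union> {(Inr v, Inl u) | u v. u \<in> pverts G \<and> v \<in> pverts H} \<rparr>"

lemma pair_graph_join:
  assumes "pair_graph G" and "pair_graph H"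
  shows "pair_graph (join G H)"
proof -
  interpret G: pair_graph G by fact
  interpret H: pair_graph H by fact
  have wf: "parcs (join G H) \<subseteq> pverts (join G H) \<times> pverts (join G H)"
    by (auto simp: join_def dest: G.in_arcsD1 G.in_arcsD2 H.in_arcsD1 H.in_arcsD2)
  have fin: "finite (pverts (join G H))"
    by (simp add: join_def)
  show ?thesis
  proof
    show "finite (parcs (join G H))"
      using finite_subset[OF wf] fin by blast
    show "symmetric (with_proj (join G H))"
      by (auto simp: symmetric_def join_def sym_def dest: G.arcs_symmetric H.arcs_symmetric)
    show "fst e \<in> pverts (join G H)" and "snd e \<in> pverts (join G H)"
      if "e \<in> parcs (join G H)" for e
      using that wf by auto
    show "fst e \<noteq> snd e" if "e \<in> parcs (join G H)" for e
      using that by (auto simp: join_def dest: G.no_loops' H.no_loops')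
  qed (fact fin)
qed

definition is_clique :: "'a pair_pre_digraph \<Rightarrow> 'a set \<Rightarrow> bool" where
  "is_clique G K \<longleftrightarrow> K \<subseteq> pverts G \<and> pairwise (\<lambda>u v. (u, v) \<in> parcs G) K"

definition clique_number :: "'a pair_pre_digraph \<Rightarrow> nat" where
  "clique_number G = Max {card K | K. is_clique G K}"

text \<open>A path is given by its list of vertices, which are distinct by \<open>vpath\<close>.\<close>

definition monophonic_path :: "'a pair_pre_digraph \<Rightarrow> 'a list \<Rightarrow> bool" where
  "monophonic_path G p \<longleftrightarrow> vpath p (with_proj G) \<and>
     (\<forall>i<length p. \<forall>j<length p. (p ! i, p ! j) \<in> parcs G \<longrightarrow> j = Suc i \<or> i = Suc j)"

definition mp_set :: "'a pair_pre_digraph \<Rightarrow> 'a set \<Rightarrow> bool" where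
  "mp_set G M \<longleftrightarrow> M \<subseteq> pverts G \<and>
     \<not> (\<exists>x\<in>M. \<exists>y\<in>M. \<exists>z\<in>M. x \<noteq> y \<and> y \<noteq> z \<and> x \<noteq> z \<and>
          (\<exists>p. monophonic_path G p \<and> {x, y, z} \<subseteq> set p))"

definition mp_number :: "'a pair_pre_digraph \<Rightarrow> nat" where
  "mp_number G = Max {card M | M. mp_set G M}"

end

theory Submission
  imports Defs
begin

text \<open>
  An induced path of \<open>G \<or> H\<close> that meets both sides has at most two vertices on each side, since a
  vertex of the other side is adjacent to, hence consecutive with, all of them.  So three vertices
  of \<open>G\<close> lie on a common induced path of the join iff they do in \<open>G\<close>, and mp-sets inside one side
  are those of that side.  If an mp-set meets both sides, two non-adjacent vertices \<open>x\<close>, \<open>y\<close> of one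
  side would form an induced path \<open>x, w, y\<close> with any vertex \<open>w\<close> of the other; hence both parts are
  cliques, and conversely a clique of the join is an mp-set.
\<close>

section \<open>Induced paths and cliques in a single graph\<close>

text \<open>The walk condition hidden in \<open>vpath\<close> supplies the converse of the
  implication in the definition. As an equivalence on indices, the condition can be rewritten along
  maps that preserve and reflect arcs.\<close>

lemma (in pair_graph) monophonic_path_iff:
  "monophonic_path G p \<longleftrightarrow> p \<noteq> [] \<and> set p \<subseteq> pverts G \<and> distinct p \<and>
     (\<forall>i<length p. \<forall>j<length p. (p ! i, p ! j) \<in> parcs G \<longleftrightarrow> j = Suc i \<or> i = Suc j)"
proof -
  have "vwalk_arcs q = zip q (tl q)" for q :: "'a list"
    by (induction q rule: vwalk_arcs.induct) (simp_all del: vwalk_arcs_Cons)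
  then have "set (vwalk_arcs q) = {(q ! i, q ! Suc i) | i. Suc i < length q}" for q :: "'a list"
    by (auto simp: set_zip nth_tl)
  then have "vpath p (with_proj G) \<longleftrightarrow> p \<noteq> [] \<and> set p \<subseteq> pverts G \<and> distinct p \<and>
     (\<forall>i. Suc i < length p \<longrightarrow> (p ! i, p ! Suc i) \<in> parcs G)"
    by (auto simp: vpath_def vwalk_def)
  moreover have "(\<forall>i. Suc i < length p \<longrightarrow> (p ! i, p ! Suc i) \<in> parcs G) \<longleftrightarrow>
     (\<forall>i<length p. \<forall>j<length p. j = Suc i \<or> i = Suc j \<longrightarrow> (p ! i, p ! j) \<in> parcs G)"
    using arcs_symmetric Suc_lessD by blast
  ultimately show ?thesis
    unfolding monophonic_path_def by blast
qed

lemma (in pair_graph) monophonic_path_triple: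
  assumes "(x, w) \<in> parcs G" and "(w, y) \<in> parcs G" and "x \<noteq> y" and "(x, y) \<notin> parcs G"
  shows "monophonic_path G [x, w, y]"
proof -
  have "x \<noteq> w" "w \<noteq> y" "x \<in> pverts G" "w \<in> pverts G" "y \<in> pverts G"
    using assms no_loops' in_arcsD1 in_arcsD2 by blast+
  moreover have "(w, x) \<in> parcs G" "(y, w) \<in> parcs G" "(y, x) \<notin> parcs G"
    using assms arcs_symmetric by blast+
  \<comment> \<open>The index condition of \<open>monophonic_path_iff\<close> includes the case of
    equal indices, so the absence of loops is part of the check.\<close>
  moreover have "(u, u) \<notin> parcs G" for u
    using no_loops' by blast
  ultimately show ?thesis
    using assms by (simp add: monophonic_path_iff All_less_Suc numeral_3_eq_3)
qed

lemma mp_setD: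
  assumes "mp_set G M" and "x \<in> M" and "y \<in> M" and "z \<in> M"
    and "x \<noteq> y" and "y \<noteq> z" and "x \<noteq> z" and "monophonic_path G p"
  shows "\<not> {x, y, z} \<subseteq> set p"
  using assms unfolding mp_set_def by blast

text \<open>Otherwise \<open>[x, w, y]\<close> would be an induced path through three vertices of
  \<open>M\<close>. In the join, \<open>w\<close> will be taken on the side opposite to
  \<open>x\<close> and \<open>y\<close>.\<close>

lemma mp_set_arc_if_common_neighbour:
  assumes "pair_graph G" and "mp_set G M" and "w \<in> M" and "x \<in> M" and "y \<in> M" and "x \<noteq> y"
    and "(x, w) \<in> parcs G" and "(w, y) \<in> parcs G"
  shows "(x, y) \<in> parcs G"
proof (rule ccontr)
  assume "(x, y) \<notin> parcs G"
  interpret pair_graph G by fact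
  have "monophonic_path G [x, w, y]"
    using assms \<open>(x, y) \<notin> parcs G\<close> by (intro monophonic_path_triple)
  moreover have "x \<noteq> w" "w \<noteq> y"
    using assms by (auto dest: no_loops')
  ultimately have "\<not> {x, w, y} \<subseteq> set [x, w, y]"
    using assms by (intro mp_setD)
  then show False
    by simp
qed

text \<open>Adjacent vertices of an induced path are consecutive on it, and three positions cannot
  pairwise differ by exactly one.\<close>

lemma mp_set_if_is_clique:
  assumes "pair_graph G" and "is_clique G K"
  shows "mp_set G K"
proof -
  have False if K: "x \<in> K" "y \<in> K" "z \<in> K" and ne: "x \<noteq> y" "y \<noteq> z" "x \<noteq> z"
    and p: "monophonic_path G p" and sub: "{x, y, z} \<subseteq> set p" for x y z p
  proof -
    obtain i j k where ijk: "i < length p" "j < length p" "k < length p"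
      "x = p ! i" "y = p ! j" "z = p ! k"
      using sub by (auto simp: in_set_conv_nth)
    have "(x, y) \<in> parcs G" "(y, z) \<in> parcs G" "(x, z) \<in> parcs G"
      using assms(2) K ne by (auto simp: is_clique_def pairwise_def)
    then have "j = Suc i \<or> i = Suc j" "k = Suc j \<or> j = Suc k" "k = Suc i \<or> i = Suc k"
      using p ijk unfolding monophonic_path_def by auto
    then show False
      by linarith
  qed
  with assms(2) show ?thesis
    unfolding mp_set_def is_clique_def by blast
qed

section \<open>Transfer along embeddings as induced subgraphs\<close>

lemma monophonic_path_map_iff:
  assumes "pair_graph G" and "pair_graph H" and "inj_on f (pverts G)"
    and "f ` pverts G \<subseteq> pverts H"
    and "\<And>u v. u \<in> pverts G \<Longrightarrow> v \<in> pverts G \<Longrightarrow> (f u, f v) \<in> parcs H \<longleftrightarrow> (u, v) \<in> parcs G"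
    and "set p \<subseteq> pverts G"
  shows "monophonic_path H (map f p) \<longleftrightarrow> monophonic_path G p"
proof -
  have "inj_on f (set p)"
    using assms(3,6) by (rule inj_on_subset)
  moreover have "p ! i \<in> pverts G" if "i < length p" for i
    using assms(6) that by (meson nth_mem subsetD)
  ultimately show ?thesis
    using assms(4,5,6) unfolding pair_graph.monophonic_path_iff[OF assms(1)]
      pair_graph.monophonic_path_iff[OF assms(2)]
    by (auto simp: distinct_map image_subset_iff subset_iff)
qed

text \<open>By \<open>dom\<close>, an induced path of \<open>H\<close> through three vertices of the
  image cannot leave the image, so it pulls back to \<open>G\<close>. The abstract map
  \<open>f\<close> lets one proof serve both \<open>Inl\<close> and \<open>Inr\<close>.\<close>

lemma mp_set_image_iff:
  assumes G: "pair_graph G" and H: "pair_graph H" and inj: "inj_on f (pverts G)"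
    and sub: "f ` pverts G \<subseteq> pverts H"
    and ind: "\<And>u v. u \<in> pverts G \<Longrightarrow> v \<in> pverts G \<Longrightarrow> (f u, f v) \<in> parcs H \<longleftrightarrow> (u, v) \<in> parcs G"
    and dom: "\<And>u w. u \<in> pverts G \<Longrightarrow> w \<in> pverts H - f ` pverts G \<Longrightarrow> (f u, w) \<in> parcs H"
    and M: "M \<subseteq> pverts G"
  shows "mp_set H (f ` M) \<longleftrightarrow> mp_set G M"
proof -
  have "(\<exists>q. monophonic_path H q \<and> {f x, f y, f z} \<subseteq> set q)
      \<longleftrightarrow> (\<exists>p. monophonic_path G p \<and> {x, y, z} \<subseteq> set p)" (is "?L \<longleftrightarrow> ?R")
    if V: "x \<in> pverts G" "y \<in> pverts G" "z \<in> pverts G" and ne: "x \<noteq> y" "y \<noteq> z" "x \<noteq> z" for x y z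
  proof
    assume ?R
    then obtain p where p: "monophonic_path G p" "{x, y, z} \<subseteq> set p"
      by blast
    then have "set p \<subseteq> pverts G"
      using pair_graph.monophonic_path_iff[OF G] by blast
    then have "monophonic_path H (map f p)"
      using monophonic_path_map_iff[OF G H inj sub ind] p(1) by blast
    with p(2) show ?L
      by (intro exI[of _ "map f p"]) auto
  next
    assume ?L
    then obtain q where q: "monophonic_path H q" "{f x, f y, f z} \<subseteq> set q"
      by blast
    have "set q \<subseteq> f ` pverts G"
    proof
      fix w assume "w \<in> set q"
      show "w \<in> f ` pverts G"
      proof (rule ccontr)
        assume "w \<notin> f ` pverts G"
        moreover have "w \<in> pverts H"
          using \<open>w \<in> set q\<close> q(1) pair_graph.monophonic_path_iff[OF H] by blast
        ultimately have "(f x, w) \<in> parcs H" "(f y, w) \<in> parcs H" "(f z, w) \<in> parcs H"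
          using dom V by auto
        moreover obtain i j k l where ijkl: "i < length q" "j < length q" "k < length q"
          "l < length q" "f x = q ! i" "f y = q ! j" "f z = q ! k" "w = q ! l"
          using q(2) \<open>w \<in> set q\<close> by (auto simp: in_set_conv_nth)
        ultimately have "l = Suc i \<or> i = Suc l" "l = Suc j \<or> j = Suc l" "l = Suc k \<or> k = Suc l"
          using q(1) unfolding monophonic_path_def by auto
        \<comment> \<open>Position \<open>l\<close> has at most two neighbouring positions,
          \<open>l - 1\<close> and \<open>l + 1\<close>, so it cannot be next to three different
          ones.\<close>
        then have "i = j \<or> j = k \<or> i = k"
          by linarith
        then show False
          using ijkl V ne inj by (metis inj_on_eq_iff)
      qed
    qed
    \<comment> \<open>A list over the image of \<open>f\<close> is the image of a list, which gives
      the preimage path \<open>p\<close>.\<close>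
    then have "q \<in> map f ` lists (pverts G)"
      unfolding lists_image[symmetric] by auto
    then obtain p where p: "q = map f p" "set p \<subseteq> pverts G"
      by auto
    then have "monophonic_path G p"
      using monophonic_path_map_iff[OF G H inj sub ind] q(1) by blast
    moreover have "{x, y, z} \<subseteq> set p"
      using q(2) p V inj by (auto simp: inj_on_image_mem_iff)
    ultimately show ?R
      by blast
  qed
  note path_iff = this
  have ne_iff: "f x \<noteq> f y \<longleftrightarrow> x \<noteq> y" if "x \<in> pverts G" "y \<in> pverts G" for x y
    using inj that by (meson inj_on_def)
  have triples: "(f x \<noteq> f y \<and> f y \<noteq> f z \<and> f x \<noteq> f z \<and>
        (\<exists>q. monophonic_path H q \<and> {f x, f y, f z} \<subseteq> set q))
      \<longleftrightarrow> (x \<noteq> y \<and> y \<noteq> z \<and> x \<noteq> z \<and> (\<exists>p. monophonic_path G p \<and> {x, y, z} \<subseteq> set p))"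
    if "x \<in> M" "y \<in> M" "z \<in> M" for x y z
  proof -
    have "x \<in> pverts G" "y \<in> pverts G" "z \<in> pverts G"
      using that M by auto
    then show ?thesis
      \<comment> \<open>\<open>path_iff\<close> holds for distinct vertices only;
        \<open>conj_cong\<close> hands it the three inequalities as assumptions.\<close>
      by (simp only: ne_iff) (intro conj_cong refl path_iff)
  qed
  have "f ` M \<subseteq> pverts H"
    using sub M by blast
  then show ?thesis
    using M unfolding mp_set_def by (simp only: bex_simps(7) triples simp_thms cong: bex_cong)
qed

section \<open>The maxima exist and are attained\<close>

lemma finite_cards_of_subsets:
  assumes "finite V" and "\<And>M. P M \<Longrightarrow> M \<subseteq> V"
  shows "finite {card M | M. P M}"
proof (rule finite_subset)
  show "{card M | M. P M} \<subseteq> card ` Pow V"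
    using assms(2) by blast
  show "finite (card ` Pow V)"
    using assms(1) by simp
qed

lemma card_le_mp_number:
  assumes "finite (pverts G)" and "mp_set G M"
  shows "card M \<le> mp_number G"
  unfolding mp_number_def
proof (rule Max_ge)
  show "finite {card M | M. mp_set G M}"
    using assms(1) by (rule finite_cards_of_subsets) (simp add: mp_set_def)
qed (use assms(2) in blast)

lemma mp_number_attained:
  assumes "finite (pverts G)"
  obtains M where "mp_set G M" and "card M = mp_number G"
proof -
  \<comment> \<open>The empty set makes the set of cardinalities nonempty, as \<open>Max_in\<close>
    requires.\<close>
  have "mp_set G {}"
    by (simp add: mp_set_def)
  moreover have "finite {card M | M. mp_set G M}"
    using assms by (rule finite_cards_of_subsets) (simp add: mp_set_def)
  ultimately have "mp_number G \<in> {card M | M. mp_set G M}"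
    unfolding mp_number_def by (intro Max_in) blast+
  with that show thesis
    by force
qed

lemma card_le_clique_number:
  assumes "finite (pverts G)" and "is_clique G K"
  shows "card K \<le> clique_number G"
  unfolding clique_number_def
proof (rule Max_ge)
  show "finite {card K | K. is_clique G K}"
    using assms(1) by (rule finite_cards_of_subsets) (simp add: is_clique_def)
qed (use assms(2) in blast)

lemma clique_number_attained:
  assumes "finite (pverts G)"
  obtains K where "is_clique G K" and "card K = clique_number G"
proof -
  have "is_clique G {}"
    by (simp add: is_clique_def)
  moreover have "finite {card K | K. is_clique G K}"
    using assms by (rule finite_cards_of_subsets) (simp add: is_clique_def)
  ultimately have "clique_number G \<in> {card K | K. is_clique G K}"
    unfolding clique_number_def by (intro Max_in) blast+
  with that show thesis
    by force
qed

section \<open>Cliques and mp-sets of the join\<close>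

lemma pverts_join [simp]: "pverts (join G H) = pverts G <+> pverts H"
  by (simp add: join_def)

lemma parcs_join_simps [simp]:
  "(Inl u, Inl u') \<in> parcs (join G H) \<longleftrightarrow> (u, u') \<in> parcs G"
  "(Inr v, Inr v') \<in> parcs (join G H) \<longleftrightarrow> (v, v') \<in> parcs H"
  "(Inl u, Inr v) \<in> parcs (join G H) \<longleftrightarrow> u \<in> pverts G \<and> v \<in> pverts H"
  "(Inr v, Inl u) \<in> parcs (join G H) \<longleftrightarrow> u \<in> pverts G \<and> v \<in> pverts H"
  by (auto simp: join_def)

lemma is_clique_join:
  assumes "is_clique G A" and "is_clique H B"
  shows "is_clique (join G H) (A <+> B)"
  using assms by (fastforce simp: is_clique_def pairwise_def)

text \<open>The vertices outside the image of \<open>Inl\<close> are those of \<open>H\<close>, and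
  the join makes each of them adjacent to the whole image.\<close>

lemma mp_set_join_Inl_iff:
  assumes "pair_graph G" and "pair_graph H" and "A \<subseteq> pverts G"
  shows "mp_set (join G H) (Inl ` A) \<longleftrightarrow> mp_set G A"
  using assms by (intro mp_set_image_iff pair_graph_join) auto

lemma mp_set_join_Inr_iff:
  assumes "pair_graph G" and "pair_graph H" and "B \<subseteq> pverts H"
  shows "mp_set (join G H) (Inr ` B) \<longleftrightarrow> mp_set H B"
  using assms by (intro mp_set_image_iff pair_graph_join) auto

text \<open>Any \<open>b\<close> in \<open>B\<close> is a common neighbour of all of
  \<open>A\<close> in the join, and symmetrically for any \<open>a\<close> in \<open>A\<close>; both
  lie in the mp-set.\<close>

lemma is_clique_if_mp_set_join:
  assumes G: "pair_graph G" and H: "pair_graph H"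
    and mp: "mp_set (join G H) (A <+> B)" and "A \<noteq> {}" and "B \<noteq> {}"
  shows "is_clique G A" and "is_clique H B"
proof -
  have sub: "A \<subseteq> pverts G" "B \<subseteq> pverts H"
    using mp by (auto simp: mp_set_def)
  obtain a b where "a \<in> A" "b \<in> B"
    using assms by blast
  note arcI = mp_set_arc_if_common_neighbour[OF pair_graph_join[OF G H] mp]
  have "(x, y) \<in> parcs G" if "x \<in> A" "y \<in> A" "x \<noteq> y" for x y
    using arcI[of "Inr b" "Inl x" "Inl y"] that sub \<open>b \<in> B\<close> by auto
  then show "is_clique G A"
    using sub by (auto simp: is_clique_def pairwise_def)
  have "(x, y) \<in> parcs H" if "x \<in> B" "y \<in> B" "x \<noteq> y" for x y
    using arcI[of "Inl a" "Inr x" "Inr y"] that sub \<open>a \<in> A\<close> by auto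
  then show "is_clique H B"
    using sub by (auto simp: is_clique_def pairwise_def)
qed

theorem proposition3p8:
  fixes G :: "'a pair_pre_digraph" and H :: "'b pair_pre_digraph"
  assumes "pair_graph G" and "pverts G \<noteq> {}"
    and "pair_graph H" and "pverts H \<noteq> {}"
  shows "mp_number (join G H) =
           Max {clique_number G + clique_number H, mp_number G, mp_number H}"
proof -
  note G = assms(1) and H = assms(3)
  note J = pair_graph_join[OF G H]
  interpret G: pair_graph G by (fact G)
  interpret H: pair_graph H by (fact H)
  have fin: "finite (pverts G)" "finite (pverts H)" "finite (pverts (join G H))"
    by simp_all
  have "clique_number G + clique_number H \<le> mp_number (join G H)"
  proof -
    obtain A where A: "is_clique G A" "card A = clique_number G"
      using clique_number_attained fin(1) by blast
    obtain B where B: "is_clique H B" "card B = clique_number H"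
      using clique_number_attained fin(2) by blast
    have "finite A" "finite B"
      using A(1) B(1) fin by (auto simp: is_clique_def intro: finite_subset)
    then show ?thesis
      using card_le_mp_number[OF fin(3) mp_set_if_is_clique[OF J is_clique_join[OF A(1) B(1)]]] A B
      by (simp add: card_Plus)
  qed
  moreover have "mp_number G \<le> mp_number (join G H)"
  proof -
    obtain A where A: "mp_set G A" "card A = mp_number G"
      using mp_number_attained fin(1) by blast
    then have "mp_set (join G H) (Inl ` A)"
      using mp_set_join_Inl_iff[OF G H] by (auto simp: mp_set_def)
    then show ?thesis
      using card_le_mp_number[OF fin(3)] A by (force simp: card_image)
  qed
  moreover have "mp_number H \<le> mp_number (join G H)"
  proof -
    obtain B where B: "mp_set H B" "card B = mp_number H"
      using mp_number_attained fin(2) by blast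
    then have "mp_set (join G H) (Inr ` B)"
      using mp_set_join_Inr_iff[OF G H] by (auto simp: mp_set_def)
    then show ?thesis
      using card_le_mp_number[OF fin(3)] B by (force simp: card_image)
  qed
  \<comment> \<open>The upper bound is a disjunction: which of the three quantities bounds a largest
    mp-set depends on which sides it meets.\<close>
  moreover have "mp_number (join G H) \<le> clique_number G + clique_number H \<or>
    mp_number (join G H) \<le> mp_number G \<or> mp_number (join G H) \<le> mp_number H"
  proof -
    obtain M where M: "mp_set (join G H) M" "card M = mp_number (join G H)"
      using mp_number_attained fin(3) by blast
    define A B where "A = Inl -` M" and "B = Inr -` M"
    have M_eq: "M = A <+> B"
      proof (rule set_eqI)
      show "x \<in> M \<longleftrightarrow> x \<in> A <+> B" for x
        by (cases x) (auto simp: A_def B_def)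
    qed
    have sub: "A \<subseteq> pverts G" "B \<subseteq> pverts H"
      using M(1) unfolding M_eq by (auto simp: mp_set_def)
    then have card: "card M = card A + card B"
      unfolding M_eq using fin by (auto intro!: card_Plus intro: finite_subset)
    consider "A = {}" | "B = {}" | "A \<noteq> {}" "B \<noteq> {}"
      by blast
    then show ?thesis
    proof cases
      \<comment> \<open>\<open>M\<close> lies in the copy of \<open>H\<close>, so its size is at
        most \<open>mp_number H\<close>.\<close>
      case 1
      then have "mp_set H B"
        using M(1) mp_set_join_Inr_iff[OF G H sub(2)] by (simp add: M_eq Plus_def)
      then show ?thesis
        using card_le_mp_number[OF fin(2)] card M(2) 1 by fastforce
    next
      case 2
      then have "mp_set G A"
        using M(1) mp_set_join_Inl_iff[OF G H sub(1)] by (simp add: M_eq Plus_def)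
      then show ?thesis
        using card_le_mp_number[OF fin(1)] card M(2) 2 by fastforce
    next
      \<comment> \<open>\<open>M\<close> meets both sides, so both parts are cliques and the clique
        numbers bound them separately.\<close>
      case 3
      then have "is_clique G A" "is_clique H B"
        using is_clique_if_mp_set_join[OF G H] M(1) unfolding M_eq by blast+
      then show ?thesis
        using card_le_clique_number fin card M(2) by (metis add_mono)
    qed
  qed
  ultimately show ?thesis
    by (simp add: max_def) linarith
qed

end
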